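(* Let $G$ be a (finite, simple) graph with $m \geq 1$ edges, and let $\prec$ be any fixed total order of the vertices of $G$. Then the edge set of $G$ can be partitioned into at most $\lfloor \sqrt{2m} \rfloor$ sets, each of which is either a stack or a queue with respect to $\prec$. In particular, the mixed page number of $G$ respecting $\prec$ is at most $\lfloor \sqrt{2m} \rfloor$.
   Context: Given a total vertex order $\prec$, two edges $(u_1,v_1)$, $(u_2,v_2)$ with four distinct endpoints and $u_1\prec v_1$, $u_2 \prec v_2$, $u_1 \prec u_2$ are said to cross if $u_1 \prec u_2 \prec v_1 \prec v_2$, and to nest if $u_1 \prec u_2 \prec v_2 \prec v_1$. A stack is a set of edges no two of which cross; a queue is a set of edges no two of which nest (edges sharing an endpoint never cross or nest). An $s$-stack $q$-queue layout of $G$ consists of a total vertex order together with a partition of the edges into $s$ stacks and $q$ queues. The mixed page number of $G$ respecting a fixed order $\prec$ is the minimum $s+q$ over all $s$-stack $q$-queue layouts using the order $\prec$. *)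

theory Defs
  imports Complex_Main "HOL-Library.Disjoint_Sets"
begin

definition simple_graph :: "'a set \<Rightarrow> 'a set set \<Rightarrow> bool" where
  "simple_graph V E \<longleftrightarrow> finite V \<and> (\<forall>e\<in>E. e \<subseteq> V \<and> card e = 2)"

text \<open>
  A strict vertex order is a relation \<open>r\<close>, with \<open>(u, v) \<in> r\<close> meaning that \<open>u\<close> precedes \<open>v\<close>.
  Comparing \<open>{e, f}\<close> with \<open>{{u1, v1}, {u2, v2}}\<close> expresses that the two edges may be
  named in either order, so that \<open>u1\<close> can be taken to precede \<open>u2\<close>.
\<close>

definition edges_cross :: "'a rel \<Rightarrow> 'a set \<Rightarrow> 'a set \<Rightarrow> bool" where
  "edges_cross r e f \<longleftrightarrow>
    (\<exists>u1 v1 u2 v2. {e, f} = {{u1, v1}, {u2, v2}} \<and> distinct [u1, v1, u2, v2] \<and>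
      (u1, u2) \<in> r \<and> (u2, v1) \<in> r \<and> (v1, v2) \<in> r)"

definition edges_nest :: "'a rel \<Rightarrow> 'a set \<Rightarrow> 'a set \<Rightarrow> bool" where
  "edges_nest r e f \<longleftrightarrow>
    (\<exists>u1 v1 u2 v2. {e, f} = {{u1, v1}, {u2, v2}} \<and> distinct [u1, v1, u2, v2] \<and>
      (u1, u2) \<in> r \<and> (u2, v2) \<in> r \<and> (v2, v1) \<in> r)"

definition is_stack :: "'a rel \<Rightarrow> 'a set set \<Rightarrow> bool" where
  "is_stack r S \<longleftrightarrow> (\<forall>e\<in>S. \<forall>f\<in>S. \<not> edges_cross r e f)"

definition is_queue :: "'a rel \<Rightarrow> 'a set set \<Rightarrow> bool" where
  "is_queue r Q \<longleftrightarrow> (\<forall>e\<in>Q. \<forall>f\<in>Q. \<not> edges_nest r e f)"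

text \<open>
  \<open>SS\<close> and \<open>QQ\<close> are the families of stacks and of queues. The parts of a \<open>partition_on\<close> are
  nonempty; allowing empty parts would not change the minimum of \<open>s + q\<close>.
\<close>

definition stack_queue_layout ::
  "nat \<Rightarrow> nat \<Rightarrow> 'a set \<Rightarrow> 'a set set \<Rightarrow> 'a rel \<Rightarrow> 'a set set set \<Rightarrow> 'a set set set \<Rightarrow> bool" where
  "stack_queue_layout s q V E r SS QQ \<longleftrightarrow>
    strict_linear_order_on V r \<and>
    partition_on E (SS \<union> QQ) \<and> SS \<inter> QQ = {} \<and>
    finite SS \<and> card SS = s \<and> (\<forall>S\<in>SS. is_stack r S) \<and>
    finite QQ \<and> card QQ = q \<and> (\<forall>Q\<in>QQ. is_queue r Q)"

text \<open>
  The minimum is attained for every finite simple graph and total order, since the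
  partition of the edges into singletons consists of stacks.
\<close>

definition mixed_page_number :: "'a set \<Rightarrow> 'a set set \<Rightarrow> 'a rel \<Rightarrow> nat" where
  "mixed_page_number V E r =
    (LEAST k. \<exists>s q SS QQ. k = s + q \<and> stack_queue_layout s q V E r SS QQ)"

end

theory Submission imports Defs begin

text \<open>
  Proper nesting is a strict partial order on the edges; its antichains are queues and its
  chains are stacks, since nested edges do not cross. Let \<open>2 m < (k + 1) (k + 2)\<close>. If there is a
  chain of \<open>k + 1\<close> edges, make it one part; the remaining edges satisfy the bound for
  \<open>k - 1\<close>. Otherwise Mirsky's theorem yields a partition into \<open>k\<close> antichains. The choice
  \<open>k = \<lfloor>sqrt (2 m)\<rfloor>\<close> is admissible because \<open>2 m < (k + 1)\<^sup>2\<close>.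
\<close>

text \<open>Mirsky's argument by induction on \<open>n\<close>: split off the minimal elements of
  \<open>A\<close> and apply the induction hypothesis to the rest. A chain found there grows
  downwards by one element; a colouring found there is extended by one new colour for the minimal
  elements. Chains are lists, so the least element is the head.\<close>

lemma chain_or_antichain_colouring:
  assumes "transp R"
  shows "(\<exists>xs. set xs \<subseteq> A \<and> sorted_wrt R xs \<and> length xs = Suc n) \<or>
    (\<exists>f::'b \<Rightarrow> nat. (\<forall>x\<in>A. f x < n) \<and> (\<forall>x\<in>A. \<forall>y\<in>A. f x = f y \<longrightarrow> \<not> R x y))"
proof (induction n arbitrary: A)
  case 0
  show ?case
  proof (cases "A = {}")
    case False
    then obtain x where "x \<in> A" by blast
    then have "set [x] \<subseteq> A \<and> sorted_wrt R [x] \<and> length [x] = Suc 0" by simp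
    then show ?thesis by blast
  qed simp
next
  case (Suc n)
  \<comment> \<open>Every element of \<open>B\<close> has a predecessor in \<open>A\<close>, which
    is what prolongs a chain; no element of \<open>A - B\<close> has one, so \<open>A - B\<close> is
    an antichain and can share colour \<open>n\<close>.\<close>
  define B where "B = {x\<in>A. \<exists>y\<in>A. R y x}"
  from Suc.IH[of B] show ?case
  proof (elim disjE exE conjE)
    fix xs assume xs: "set xs \<subseteq> B" "sorted_wrt R xs" "length xs = Suc n"
    then obtain x ys where x: "xs = x # ys" by (cases xs) auto
    with xs obtain y where y: "y \<in> A" "R y x" by (auto simp: B_def)
    have "R y z" if "z \<in> set ys" for z
      using that xs(2) y(2) x transpD[OF assms, of y x z] by simp
    with xs(2) x y(2) have "sorted_wrt R (y # xs)" by simp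
    moreover have "set (y # xs) \<subseteq> A" using xs y by (auto simp: B_def)
    ultimately show ?thesis using xs(3) by (metis length_Cons)
  next
    fix f :: "'b \<Rightarrow> nat"
    assume f: "\<forall>x\<in>B. f x < n" "\<forall>x\<in>B. \<forall>y\<in>B. f x = f y \<longrightarrow> \<not> R x y"
    let ?g = "\<lambda>x. if x \<in> B then f x else n"
    have "\<forall>x\<in>A. ?g x < Suc n" using f(1) by (auto simp: less_SucI)
    moreover have "\<not> R x y" if "x \<in> A" "y \<in> A" "?g x = ?g y" for x y
    proof (cases "y \<in> B")
      case True
      then show ?thesis using that f by (auto split: if_splits)
    next
      case False
      then show ?thesis using that by (auto simp: B_def)
    qed
    ultimately show ?thesis by (intro disjI2 exI[of _ ?g]) blast
  qed
qed

lemma chain_antichain_colouring: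
  fixes A :: "'b set"
  assumes "transp R" "irreflp R" "finite A" "2 * card A < (k + 1) * (k + 2)"
  shows "\<exists>f::'b \<Rightarrow> nat. (\<forall>x\<in>A. f x < k) \<and>
    (\<forall>i. (\<forall>x\<in>A. \<forall>y\<in>A. f x = i \<longrightarrow> f y = i \<longrightarrow> x \<noteq> y \<longrightarrow> R x y \<or> R y x) \<or>
         (\<forall>x\<in>A. \<forall>y\<in>A. f x = i \<longrightarrow> f y = i \<longrightarrow> \<not> R x y))"
  using assms(3,4)
proof (induction k arbitrary: A)
  case 0
  then have "card A = 0" by presburger
  then have "A = {}" using 0 by simp
  then show ?case by simp
next
  case (Suc k)
  \<comment> \<open>Either a chain of \<open>k + 2\<close> elements exists, or \<open>Suc k\<close>
    antichains already suffice.\<close>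
  from chain_or_antichain_colouring[OF assms(1), of A "Suc k"] show ?case
  proof (elim disjE exE conjE)
    fix xs assume xs: "set xs \<subseteq> A" "sorted_wrt R xs" "length xs = Suc (Suc k)"
    have "distinct xs" using xs(2) assms(2)
      by (induction xs) (auto dest: irreflpD)
    then have "card (set xs) = k + 2" using xs(3) by (simp add: distinct_card)
    then have "card A = card (A - set xs) + (k + 2)"
      using xs(1) Suc.prems(1) card_Diff_subset[of "set xs" A] card_mono[of A "set xs"] by simp
    \<comment> \<open>\<open>(k + 2) * (k + 3) - 2 * (k + 2) = (k + 1) * (k + 2)\<close>: removing
      the chain costs exactly one colour in the bound.\<close>
    then have "2 * card (A - set xs) < (k + 1) * (k + 2)"
      using Suc.prems(2) by (simp add: algebra_simps)
    then obtain f where f: "\<forall>x\<in>A - set xs. f x < k"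
      "\<And>i. (\<forall>x\<in>A - set xs. \<forall>y\<in>A - set xs. f x = i \<longrightarrow> f y = i \<longrightarrow> x \<noteq> y \<longrightarrow> R x y \<or> R y x) \<or>
         (\<forall>x\<in>A - set xs. \<forall>y\<in>A - set xs. f x = i \<longrightarrow> f y = i \<longrightarrow> \<not> R x y)"
      using Suc.IH[of "A - set xs"] Suc.prems(1) by auto
    have chain: "R x y \<or> R y x" if "x \<in> set xs" "y \<in> set xs" "x \<noteq> y" for x y
      using xs(2) that by (induction xs) auto
    let ?g = "\<lambda>x. if x \<in> set xs then k else f x"
    have "\<forall>x\<in>A. ?g x < Suc k" using f(1) by (auto simp: less_SucI)
    moreover have "(\<forall>x\<in>A. \<forall>y\<in>A. ?g x = i \<longrightarrow> ?g y = i \<longrightarrow> x \<noteq> y \<longrightarrow> R x y \<or> R y x) \<or>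
         (\<forall>x\<in>A. \<forall>y\<in>A. ?g x = i \<longrightarrow> ?g y = i \<longrightarrow> \<not> R x y)" for i
    \<comment> \<open>The values of \<open>f\<close> off the chain are below \<open>k\<close>, so
      class \<open>k\<close> of \<open>?g\<close> is the chain alone and the other classes are those
      of \<open>f\<close>.\<close>
    proof (cases "i = k")
      case True
      have "x \<in> set xs" if "x \<in> A" "?g x = i" for x
        using that f(1) True by (cases "x \<in> set xs") auto
      then show ?thesis using chain by blast
    next
      case False
      then have "x \<in> A - set xs \<and> f x = i" if "x \<in> A" "?g x = i" for x
        using that by (cases "x \<in> set xs") auto
      then show ?thesis using f(2)[of i] by blast
    qed
    ultimately show ?thesis by (intro exI[of _ ?g]) blast
  next
    fix f :: "'b \<Rightarrow> nat"
    assume "\<forall>x\<in>A. f x < Suc k" "\<forall>x\<in>A. \<forall>y\<in>A. f x = f y \<longrightarrow> \<not> R x y"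
    then show ?thesis by (intro exI[of _ f]) simp
  qed
qed

text \<open>\<open>edges_nest\<close> is symmetric in the two edges; this oriented form, with the
  inner edge first, is the strict order whose chains and antichains are coloured.\<close>

definition nested_in :: "'a rel \<Rightarrow> 'a set \<Rightarrow> 'a set \<Rightarrow> bool" where
  "nested_in r e f \<longleftrightarrow> (\<exists>u v u' v'. e = {u, v} \<and> f = {u', v'} \<and>
    (u', u) \<in> r \<and> (u, v) \<in> r \<and> (v, v') \<in> r)"

text \<open>An unordered edge determines its first and last endpoint, since the swapped reading
  would give a cycle in \<open>r\<close>. This reconciles different namings of one edge.\<close>

lemma ordered_doubleton_eq:
  assumes "trans r" "irrefl r" "{u, v} = {u', v'}" "(u, v) \<in> r" "(u', v') \<in> r"
  shows "u = u' \<and> v = v'"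
  using assms unfolding doubleton_eq_iff irrefl_def by (metis transD)

lemma transp_nested_in:
  assumes "trans r" "irrefl r"
  shows "transp (nested_in r)"
proof (rule transpI)
  fix e f g assume "nested_in r e f" "nested_in r f g"
  then obtain a b c d a' b' c' d' where e: "e = {a, b}" "f = {c, d}" "(c, a) \<in> r" "(a, b) \<in> r" "(b, d) \<in> r"
    and g: "f = {a', b'}" "g = {c', d'}" "(c', a') \<in> r" "(a', b') \<in> r" "(b', d') \<in> r"
    unfolding nested_in_def by blast
  have "(c, d) \<in> r" using e assms(1) by (meson transD)
  then have "a' = c \<and> b' = d" using ordered_doubleton_eq[OF assms] e(2) g by metis
  then have "(c', a) \<in> r" "(b, d') \<in> r" using e g assms(1) by (meson transD)+
  then show "nested_in r e g" using e g unfolding nested_in_def by blast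
qed

lemma irreflp_nested_in:
  assumes "trans r" "irrefl r"
  shows "irreflp (nested_in r)"
proof (rule irreflpI, rule notI)
  fix e assume "nested_in r e e"
  then obtain a b c d where e: "e = {a, b}" "e = {c, d}" "(c, a) \<in> r" "(a, b) \<in> r" "(b, d) \<in> r"
    unfolding nested_in_def by blast
  have "(c, d) \<in> r" using e assms(1) by (meson transD)
  then have "a = c" using ordered_doubleton_eq[OF assms] e by metis
  then show False using e assms(2) by (auto dest: irreflD)
qed

text \<open>Makes antichains of \<open>nested_in r\<close> queues.\<close>

lemma edges_nest_imp_nested_in:
  "edges_nest r e f \<Longrightarrow> nested_in r e f \<or> nested_in r f e"
  unfolding edges_nest_def nested_in_def doubleton_eq_iff[of e f] by blast

lemma edges_cross_sym: "edges_cross r e f \<Longrightarrow> edges_cross r f e"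
  unfolding edges_cross_def by (simp add: insert_commute)

text \<open>\<open>is_stack\<close> also compares an edge with itself, whereas a chain only relates
  distinct edges.\<close>

lemma edges_cross_neq: "edges_cross r e f \<Longrightarrow> e \<noteq> f"
  unfolding edges_cross_def by (auto simp: doubleton_eq_iff)

text \<open>Of two crossing edges, the one that starts first also ends first; an enclosing edge
  starts first but ends last. Case 1 below contradicts the order of the starts, case 2 that of the
  ends.\<close>

lemma nested_in_not_cross:
  assumes "trans r" "irrefl r" "nested_in r e f"
  shows "\<not> edges_cross r e f"
proof
  assume "edges_cross r e f"
  then obtain u1 v1 u2 v2 where c: "{e, f} = {{u1, v1}, {u2, v2}}"
      "(u1, u2) \<in> r" "(u2, v1) \<in> r" "(v1, v2) \<in> r"
    unfolding edges_cross_def by blast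
  obtain a b c d where n: "e = {a, b}" "f = {c, d}" "(c, a) \<in> r" "(a, b) \<in> r" "(b, d) \<in> r"
    using assms(3) unfolding nested_in_def by blast
  have r: "(c, d) \<in> r" "(u1, v1) \<in> r" "(u2, v2) \<in> r"
    using c n assms(1) by (meson transD)+
  from c(1) consider "e = {u1, v1}" "f = {u2, v2}" | "e = {u2, v2}" "f = {u1, v1}"
    unfolding doubleton_eq_iff[of e f] by blast
  then show False
  proof cases
    case 1
    then have "a = u1" "c = u2"
      using ordered_doubleton_eq[OF assms(1,2)] n r by metis+
    then show False using c(2) n(3) assms(1,2) by (meson irreflD transD)
  next
    case 2
    then have "b = v2" "d = v1"
      using ordered_doubleton_eq[OF assms(1,2)] n r by metis+
    then show False using c(4) n(5) assms(1,2) by (meson irreflD transD)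
  qed
qed

lemma stack_queue_partition_exists:
  assumes "trans r" "irrefl r" "finite E" "2 * card E < (k + 1) * (k + 2)"
  shows "\<exists>P. partition_on E P \<and> finite P \<and> card P \<le> k \<and> (\<forall>X\<in>P. is_stack r X \<or> is_queue r X)"
proof -
  obtain f :: "'a set \<Rightarrow> nat" where f: "\<forall>x\<in>E. f x < k"
    "\<And>i. (\<forall>x\<in>E. \<forall>y\<in>E. f x = i \<longrightarrow> f y = i \<longrightarrow> x \<noteq> y \<longrightarrow> nested_in r x y \<or> nested_in r y x) \<or>
         (\<forall>x\<in>E. \<forall>y\<in>E. f x = i \<longrightarrow> f y = i \<longrightarrow> \<not> nested_in r x y)"
    using chain_antichain_colouring[OF transp_nested_in[OF assms(1,2)]
        irreflp_nested_in[OF assms(1,2)] assms(3,4)] by metis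
  \<comment> \<open>Only colours that occur index the parts, so no part is empty, as
    \<open>partition_on\<close> demands.\<close>
  define P where "P = (\<lambda>i. {e\<in>E. f e = i}) ` f ` E"
  have "card P \<le> card (f ` E)" unfolding P_def using assms(3) by (intro card_image_le) simp
  also have "\<dots> \<le> card {..<k}" using f(1) by (intro card_mono) auto
  finally have "card P \<le> k" by simp
  moreover have "partition_on E P"
    unfolding P_def by (rule partition_onI) (auto simp: disjnt_def)
  moreover have "finite P" unfolding P_def using assms(3) by simp
  moreover have "is_stack r {e\<in>E. f e = i} \<or> is_queue r {e\<in>E. f e = i}" for i
    using f(2)[of i]
  proof
    assume "\<forall>x\<in>E. \<forall>y\<in>E. f x = i \<longrightarrow> f y = i \<longrightarrow> x \<noteq> y \<longrightarrow> nested_in r x y \<or> nested_in r y x"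
    then have "is_stack r {e\<in>E. f e = i}"
      unfolding is_stack_def using nested_in_not_cross[OF assms(1,2)] edges_cross_sym edges_cross_neq
      by (smt (verit) mem_Collect_eq)
    then show ?thesis ..
  next
    assume "\<forall>x\<in>E. \<forall>y\<in>E. f x = i \<longrightarrow> f y = i \<longrightarrow> \<not> nested_in r x y"
    then have "is_queue r {e\<in>E. f e = i}"
      unfolding is_queue_def using edges_nest_imp_nested_in by blast
    then show ?thesis ..
  qed
  then have "\<forall>X\<in>P. is_stack r X \<or> is_queue r X" unfolding P_def by blast
  ultimately show ?thesis by blast
qed

lemma mixed_page_number_le_card:
  assumes "strict_linear_order_on V r" "partition_on E P" "finite P"
    "\<forall>X\<in>P. is_stack r X \<or> is_queue r X"
  shows "mixed_page_number V E r \<le> card P"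
proof -
  \<comment> \<open>A part may be both a stack and a queue; counting it as a stack keeps the two
    families disjoint.\<close>
  define SS where "SS = {X\<in>P. is_stack r X}"
  have SS: "SS \<subseteq> P" "SS \<union> (P - SS) = P" by (auto simp: SS_def)
  then have "card P = card SS + card (P - SS)"
    using assms(3) by (metis card_Un_disjoint Diff_disjoint finite_Diff finite_subset)
  moreover have "stack_queue_layout (card SS) (card (P - SS)) V E r SS (P - SS)"
    unfolding stack_queue_layout_def using assms SS finite_subset[OF SS(1)] by (auto simp: SS_def)
  ultimately show ?thesis
    unfolding mixed_page_number_def by (intro Least_le) blast
qed

theorem theorem1:
  fixes V :: "'a set" and E :: "'a set set" and r :: "'a rel" and m :: nat
  assumes "simple_graph V E"
    and "card E = m" and "m \<ge> 1"
    and "strict_linear_order_on V r"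
  shows "(\<exists>P. partition_on E P \<and> finite P \<and>
            int (card P) \<le> \<lfloor>sqrt (2 * real m)\<rfloor> \<and>
            (\<forall>X\<in>P. is_stack r X \<or> is_queue r X)) \<and>
         int (mixed_page_number V E r) \<le> \<lfloor>sqrt (2 * real m)\<rfloor>"
proof -
  define k where "k = nat \<lfloor>sqrt (2 * real m)\<rfloor>"
  have k: "int k = \<lfloor>sqrt (2 * real m)\<rfloor>" by (simp add: k_def)
  then have "sqrt (2 * real m) < real k + 1" by linarith
  then have "2 * real m < (real k + 1)\<^sup>2" by (meson not_le real_le_rsqrt)
  then have "real (2 * m) < real ((k + 1)\<^sup>2)" by (simp add: add.commute)
  then have "2 * m < (k + 1)\<^sup>2" by (simp only: of_nat_less_iff)
  also have "\<dots> \<le> (k + 1) * (k + 2)" by (simp add: power2_eq_square)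
  finally have "2 * card E < (k + 1) * (k + 2)" using assms(2) by simp
  \<comment> \<open>An infinite set has \<open>card\<close> 0, which \<open>m \<ge> 1\<close>
    excludes.\<close>
  moreover have "finite E" using assms(2,3) by (metis card.infinite not_one_le_zero)
  moreover have "trans r" "irrefl r" using assms(4) by (auto simp: strict_linear_order_on_def)
  ultimately obtain P where P: "partition_on E P" "finite P" "card P \<le> k"
      "\<forall>X\<in>P. is_stack r X \<or> is_queue r X"
    using stack_queue_partition_exists by metis
  then have "mixed_page_number V E r \<le> k"
    using mixed_page_number_le_card[OF assms(4)] by (meson le_trans)
  then show ?thesis using P unfolding k[symmetric] by auto
qed

end
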